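(* Let $p$ be a prime, let $G$ be a finite group with $\frac{G}{Z(G)} \cong \mathbb{Z}_p \times \mathbb{Z}_p$, and let $x = |Z(G)|$. Then $$M_1(\mathcal{CCC}(G)) = \frac{x(p^2-1)}{p^3}\left(p^2x^2 - 2px^2 + x^2 - 2p^2x + 2px + p^2\right)$$ and $$M_2(\mathcal{CCC}(G)) = \frac{x(p^2-1)}{2p^4}\left(p^3x^3 - 3p^2x^3 + 3px^3 - x^3 - 3p^3x^2 + 6p^2x^2 - 3px^2 + 3p^3x - 3p^2x - p^3\right).$$ Further, $\frac{M_2(\mathcal{CCC}(G))}{|e(\mathcal{CCC}(G))|} = \frac{M_1(\mathcal{CCC}(G))}{|v(\mathcal{CCC}(G))|}$.
   Context: $Z(G)$ denotes the center of $G$. For a finite group $G$ and $x \in G$, $x^G$ denotes the conjugacy class of $x$ in $G$. The commuting conjugacy class graph $\mathcal{CCC}(G)$ is the simple undirected graph whose vertices are the conjugacy classes of non-central elements of $G$, where two distinct vertices $x^G$ and $y^G$ are adjacent if and only if there exist $x' \in x^G$ and $y' \in y^G$ with $x'y' = y'x'$. For a finite simple graph $\Gamma$ with vertex set $v(\Gamma)$ and edge set $e(\Gamma)$, the first and second Zagreb indices are $M_1(\Gamma) = \sum_{v \in v(\Gamma)} \deg(v)^2$ and $M_2(\Gamma) = \sum_{uv \in e(\Gamma)} \deg(u)\deg(v)$. Convention: if $\Gamma$ has no edges (so $M_1(\Gamma)=M_2(\Gamma)=0$), the quotient $M_2(\Gamma)/|e(\Gamma)|$ is read as $0$. *)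

theory Defs
  imports Complex_Main "HOL-Algebra.Algebra" "HOL-Computational_Algebra.Primes"
begin

text \<open>
  A simple undirected graph is a pair of its vertex set and its edge set, each edge being the
  two-element set of its end points.
\<close>

type_synonym 'v sgraph = "'v set \<times> 'v set set"

definition vertices :: "'v sgraph \<Rightarrow> 'v set" where
  "vertices \<Gamma> = fst \<Gamma>"

definition edges :: "'v sgraph \<Rightarrow> 'v set set" where
  "edges \<Gamma> = snd \<Gamma>"

definition vertex_degree :: "'v sgraph \<Rightarrow> 'v \<Rightarrow> nat" where
  "vertex_degree \<Gamma> v = card {e \<in> edges \<Gamma>. v \<in> e}"

definition zagreb1 :: "'v sgraph \<Rightarrow> nat" where
  "zagreb1 \<Gamma> = (\<Sum>v\<in>vertices \<Gamma>. (vertex_degree \<Gamma> v)\<^sup>2)"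

text \<open>
  For an edge \<open>e = {u, v}\<close> with \<open>u \<noteq> v\<close>, the inner product is \<open>vertex_degree \<Gamma> u * vertex_degree \<Gamma> v\<close>.
  Every unordered edge contributes once. For a graph without edges, the quotient of \<open>zagreb2\<close> by the
  number of edges is \<open>0 / 0\<close> in the reals, which is \<open>0\<close>.
\<close>

definition zagreb2 :: "'v sgraph \<Rightarrow> nat" where
  "zagreb2 \<Gamma> = (\<Sum>e\<in>edges \<Gamma>. \<Prod>v\<in>e. vertex_degree \<Gamma> v)"

definition center :: "('a, 'b) monoid_scheme \<Rightarrow> 'a set" where
  "center G = {z \<in> carrier G. \<forall>g\<in>carrier G. z \<otimes>\<^bsub>G\<^esub> g = g \<otimes>\<^bsub>G\<^esub> z}"

text \<open>The action below is the one in \<open>group.action_by_conjugation\<close>.\<close>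

definition conj_class :: "('a, 'b) monoid_scheme \<Rightarrow> 'a \<Rightarrow> 'a set" where
  "conj_class G x = orbit G (\<lambda>g. \<lambda>h\<in>carrier G. g \<otimes>\<^bsub>G\<^esub> h \<otimes>\<^bsub>G\<^esub> inv\<^bsub>G\<^esub> g) x"

definition CCC :: "('a, 'b) monoid_scheme \<Rightarrow> 'a set sgraph" where
  "CCC G =
    ({conj_class G x | x. x \<in> carrier G - center G},
     {{conj_class G x, conj_class G y} | x y.
        x \<in> carrier G - center G \<and> y \<in> carrier G - center G \<and>
        conj_class G x \<noteq> conj_class G y \<and>
        (\<exists>x'\<in>conj_class G x. \<exists>y'\<in>conj_class G y. x' \<otimes>\<^bsub>G\<^esub> y' = y' \<otimes>\<^bsub>G\<^esub> x')})"

lemma conj_class_eq: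
  assumes "x \<in> carrier G"
  shows "conj_class G x = {g \<otimes>\<^bsub>G\<^esub> x \<otimes>\<^bsub>G\<^esub> inv\<^bsub>G\<^esub> g | g. g \<in> carrier G}"
  using assms by (auto simp: conj_class_def orbit_def)

lemma CCC_simple:
  assumes "e \<in> edges (CCC G)"
  shows "e \<subseteq> vertices (CCC G)" and "card e = 2"
  using assms by (auto simp: CCC_def edges_def vertices_def card_2_iff)

end

theory Submission
  imports Defs
begin

text \<open>
  For non-central \<open>a\<close>, the centralizer \<open>C(a)\<close> lies strictly between \<open>Z(G)\<close> and \<open>G\<close>, so it has order
  \<open>px\<close>; applying the same count to the centralizer of \<open>C(a)\<close> shows that \<open>C(a)\<close> is abelian. Hence
  commuting is an equivalence relation on the non-central elements, with classes \<open>C(a) - Z(G)\<close>.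
  Since \<open>G / Z(G)\<close> is abelian, \<open>C(a) - Z(G)\<close> is a union of conjugacy classes, all of which have size
  \<open>p\<close>. So the graph is a disjoint union of complete graphs on \<open>n = (p - 1)x / p\<close> vertices; in
  particular it is regular of degree \<open>n - 1\<close>, and it has \<open>(p\<^sup>2 - 1)x / p\<close> vertices, which
  together with the handshake lemma determines both Zagreb indices.
\<close>

section \<open>Zagreb indices of regular graphs\<close>

text \<open>Regularity makes every summand of both indices equal to \<open>k^2\<close>. Counting
  incident pairs of a vertex and an edge in two ways gives the third equation.\<close>

lemma zagreb_regular:
  assumes "finite (vertices \<Gamma>)"
    and edge: "\<And>e. e \<in> edges \<Gamma> \<Longrightarrow> e \<subseteq> vertices \<Gamma> \<and> card e = 2"
    and deg: "\<And>v. v \<in> vertices \<Gamma> \<Longrightarrow> vertex_degree \<Gamma> v = k"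
  shows "zagreb1 \<Gamma> = card (vertices \<Gamma>) * k\<^sup>2"
    and "zagreb2 \<Gamma> = card (edges \<Gamma>) * k\<^sup>2"
    and "2 * card (edges \<Gamma>) = card (vertices \<Gamma>) * k"
proof -
  show "zagreb1 \<Gamma> = card (vertices \<Gamma>) * k\<^sup>2"
    by (simp add: zagreb1_def deg)
  have "(\<Prod>v\<in>e. vertex_degree \<Gamma> v) = k\<^sup>2" if "e \<in> edges \<Gamma>" for e
  proof -
    have "(\<Prod>v\<in>e. vertex_degree \<Gamma> v) = (\<Prod>v\<in>e. k)"
      using edge[OF that] deg by (intro prod.cong) auto
    then show ?thesis
      using edge[OF that] by simp
  qed
  then show "zagreb2 \<Gamma> = card (edges \<Gamma>) * k\<^sup>2"
    by (simp add: zagreb2_def)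
  have fin: "finite (edges \<Gamma>)"
    using assms(1) edge by (intro finite_subset[of "edges \<Gamma>" "Pow (vertices \<Gamma>)"]) auto
  have "\<forall>e\<in>edges \<Gamma>. card {v \<in> vertices \<Gamma>. v \<in> e} = 2"
  proof
    fix e assume "e \<in> edges \<Gamma>"
    moreover from this have "{v \<in> vertices \<Gamma>. v \<in> e} = e"
      using edge by auto
    ultimately show "card {v \<in> vertices \<Gamma>. v \<in> e} = 2"
      using edge by simp
  qed
  from sum_multicount[OF assms(1) fin this]
  show "2 * card (edges \<Gamma>) = card (vertices \<Gamma>) * k"
    using deg by (simp add: vertex_degree_def)
qed

section \<open>Centralizers, the center and conjugacy classes in an arbitrary group\<close>

text \<open>The argument is a set, so that one subgroup lemma serves centralizers of elements, the
  center and double centralizers.\<close>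

definition centralizer :: "('a, 'b) monoid_scheme \<Rightarrow> 'a set \<Rightarrow> 'a set" where
  "centralizer G A = {g \<in> carrier G. \<forall>a\<in>A. g \<otimes>\<^bsub>G\<^esub> a = a \<otimes>\<^bsub>G\<^esub> g}"

lemma center_eq_centralizer: "center G = centralizer G (carrier G)"
  by (simp add: center_def centralizer_def)

context group
begin

lemma subgroup_centralizer:
  assumes "A \<subseteq> carrier G"
  shows "subgroup (centralizer G A) G"
proof (rule subgroupI)
  show "centralizer G A \<subseteq> carrier G"
    by (auto simp: centralizer_def)
  have "\<one> \<in> centralizer G A"
    using assms by (auto simp: centralizer_def)
  then show "centralizer G A \<noteq> {}"
    by blast
next
  fix g assume g: "g \<in> centralizer G A"
  have "inv g \<otimes> a = a \<otimes> inv g" if "a \<in> A" for a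
  proof -
    have a: "a \<in> carrier G" and gc: "g \<in> carrier G" and ga: "g \<otimes> a = a \<otimes> g"
      using assms g that by (auto simp: centralizer_def)
    have "inv g \<otimes> a = inv g \<otimes> (a \<otimes> g) \<otimes> inv g"
      using a gc by (simp add: m_assoc)
    also have "\<dots> = inv g \<otimes> (g \<otimes> a) \<otimes> inv g"
      by (simp add: ga)
    also have "\<dots> = a \<otimes> inv g"
      using a gc by (simp add: m_assoc[symmetric])
    finally show ?thesis .
  qed
  then show "inv g \<in> centralizer G A"
    using g by (auto simp: centralizer_def)
next
  fix g h assume g: "g \<in> centralizer G A" and h: "h \<in> centralizer G A"
  have "g \<otimes> h \<otimes> a = a \<otimes> (g \<otimes> h)" if "a \<in> A" for a
  proof -
    have c: "a \<in> carrier G" "g \<in> carrier G" "h \<in> carrier G"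
      and e: "g \<otimes> a = a \<otimes> g" "h \<otimes> a = a \<otimes> h"
      using assms g h that by (auto simp: centralizer_def)
    have "g \<otimes> h \<otimes> a = g \<otimes> a \<otimes> h"
      using c by (simp add: m_assoc e(2))
    also have "\<dots> = a \<otimes> (g \<otimes> h)"
      using c by (simp add: m_assoc e(1))
    finally show ?thesis .
  qed
  then show "g \<otimes> h \<in> centralizer G A"
    using g h by (auto simp: centralizer_def)
qed

lemma center_subset_centralizer:
  assumes "A \<subseteq> carrier G"
  shows "center G \<subseteq> centralizer G A"
  using assms by (auto simp: center_def centralizer_def)

lemma centralizer_neq_carrier:
  assumes "a \<in> carrier G - center G"
  shows "centralizer G {a} \<noteq> carrier G"
proof -
  obtain g where "g \<in> carrier G" "a \<otimes> g \<noteq> g \<otimes> a"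
    using assms by (auto simp: center_def)
  then have "g \<notin> centralizer G {a}"
    by (auto simp: centralizer_def)
  with \<open>g \<in> carrier G\<close> show ?thesis
    by auto
qed

lemma normal_center: "center G \<lhd> G"
proof (rule normalI)
  show "subgroup (center G) G"
    by (simp add: center_eq_centralizer subgroup_centralizer)
  show "\<forall>x\<in>carrier G. center G #> x = x <# center G"
    by (auto simp: r_coset_def l_coset_def center_def)
qed

lemma subgroup_center: "subgroup (center G) G"
  using normal_center by (rule normal_imp_subgroup)

lemma subgroup_card_dvd:
  assumes "subgroup H G" "subgroup K G" "H \<subseteq> K"
  shows "card H dvd card K"
proof -
  interpret K: group "G\<lparr>carrier := K\<rparr>"
    using assms(2) by (rule subgroup_imp_group)
  have "subgroup H (G\<lparr>carrier := K\<rparr>)"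
    using assms by (rule subgroup_incl)
  from K.lagrange[OF this] have "card (rcosets\<^bsub>G\<lparr>carrier := K\<rparr>\<^esub> H) * card H = card K"
    by (simp add: order_def)
  then show ?thesis
    by (metis dvd_triv_right)
qed

text \<open>Lets the orbit-stabilizer theorem compute class sizes from centralizers.\<close>

lemma stabilizer_conjugation:
  assumes "a \<in> carrier G"
  shows "stabilizer G (\<lambda>g. \<lambda>h\<in>carrier G. g \<otimes> h \<otimes> inv g) a = centralizer G {a}"
proof -
  have "g \<otimes> a \<otimes> inv g = a \<longleftrightarrow> g \<otimes> a = a \<otimes> g" if "g \<in> carrier G" for g
    using assms that by (metis inv_solve_right m_closed)
  then show ?thesis
    using assms by (auto simp: stabilizer_def centralizer_def)
qed

lemma card_conj_class:
  assumes "a \<in> carrier G"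
  shows "card (conj_class G a) * card (centralizer G {a}) = order G"
  using group_action.orbit_stabilizer_theorem[OF action_by_conjugation assms] assms
  by (simp add: conj_class_def stabilizer_conjugation)

lemma conj_class_self:
  assumes "a \<in> carrier G"
  shows "a \<in> conj_class G a"
  using group_action.orbit_refl[OF action_by_conjugation assms] by (simp add: conj_class_def)

lemma conj_class_disjoint:
  assumes "a \<in> carrier G" "b \<in> carrier G" "conj_class G a \<noteq> conj_class G b"
  shows "conj_class G a \<inter> conj_class G b = {}"
  using group_action.disjoint_union[OF action_by_conjugation, of "conj_class G a" "conj_class G b"] assms
  by (auto simp: conj_class_def orbits_def)

lemma conj_class_noncentral:
  assumes "a \<in> carrier G - center G"
  shows "conj_class G a \<subseteq> carrier G - center G"
proof
  fix b assume "b \<in> conj_class G a"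
  then obtain g where g: "g \<in> carrier G" and b: "b = g \<otimes> a \<otimes> inv g"
    using assms by (auto simp: conj_class_eq)
  have bc: "b \<in> carrier G"
    using g assms b by auto
  \<comment> \<open>Cancelling \<open>g\<close> shows that a central conjugate of \<open>a\<close>
    would be \<open>a\<close> itself, which is not central.\<close>
  have "a = b" if "b \<in> center G"
  proof -
    have "b \<otimes> g = g \<otimes> a"
      using g assms b by (simp add: m_assoc)
    moreover have "b \<otimes> g = g \<otimes> b"
      using that g by (simp add: center_def)
    ultimately show ?thesis
      using g bc assms by simp
  qed
  then show "b \<in> carrier G - center G"
    using assms bc by auto
qed

end

section \<open>Groups whose quotient by the center is abelian of order \<open>p^2\<close>\<close>

text \<open>The isomorphism hypothesis in element form: \<open>order_eq\<close> gives the order of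
  the quotient by the center, \<open>quotient_comm\<close> its commutativity, where \<open>z\<close>
  is the commutator of \<open>a\<close> and \<open>b\<close>.\<close>

locale central_quotient_prime_square = group +
  fixes p :: nat
  assumes fin: "finite (carrier G)"
    and prime: "Factorial_Ring.prime p"
    and order_eq: "order G = p\<^sup>2 * card (center G)"
    and quotient_comm: "\<lbrakk>a \<in> carrier G; b \<in> carrier G\<rbrakk> \<Longrightarrow> \<exists>z\<in>center G. a \<otimes> b = z \<otimes> (b \<otimes> a)"
begin

lemma card_center_pos: "card (center G) > 0"
  using subgroup.finite_imp_card_positive[OF subgroup_center fin] .

text \<open>By Lagrange, \<open>card M\<close> is \<open>card (center G)\<close> times a divisor of
  \<open>p^2\<close>. The strict inclusions exclude the divisors \<open>1\<close> and
  \<open>p^2\<close>.\<close>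

lemma card_intermediate_subgroup:
  assumes "subgroup M G" "center G \<subset> M" "M \<noteq> carrier G"
  shows "card M = p * card (center G)"
proof -
  have sub: "M \<subseteq> carrier G"
    using assms(1) by (rule subgroup.subset)
  then have "finite M"
    using fin finite_subset by blast
  have "card (center G) dvd card M"
    using assms subgroup_card_dvd[OF subgroup_center] by auto
  then obtain k where k: "card M = card (center G) * k" ..
  have "card M dvd order G"
    using lagrange[OF assms(1)] by (metis dvd_triv_right)
  then have "k dvd p\<^sup>2"
    using card_center_pos by (simp add: k order_eq mult.commute)
  then obtain i where i: "i \<le> 2" "k = p ^ i"
    using prime by (auto simp: divides_primepow_nat)
  have "card (center G) < card M"
    using \<open>finite M\<close> assms(2) by (rule psubset_card_mono)
  then have "i \<noteq> 0"
    using k i by (metis less_irrefl mult_1_right power_0)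
  have "card M < order G"
    unfolding order_def using fin sub assms(3) by (intro psubset_card_mono) auto
  then have "i \<noteq> 2"
    using k i by (auto simp: order_eq)
  with \<open>i \<noteq> 0\<close> i have "i = 1"
    by simp
  then show ?thesis
    using k i by simp
qed

lemma card_centralizer:
  assumes a: "a \<in> carrier G - center G"
  shows "card (centralizer G {a}) = p * card (center G)"
proof (rule card_intermediate_subgroup)
  show "subgroup (centralizer G {a}) G"
    using a by (simp add: subgroup_centralizer)
  have "a \<in> centralizer G {a}"
    using a by (simp add: centralizer_def)
  then show "center G \<subset> centralizer G {a}"
    using a center_subset_centralizer[of "{a}"] by auto
  show "centralizer G {a} \<noteq> carrier G"
    using a by (rule centralizer_neq_carrier)
qed

text \<open>Transitivity of commuting on non-central elements: once the centralizer of
  \<open>a\<close> is known to be abelian, it lies in that of \<open>b\<close>, and both have order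
  \<open>p * card (center G)\<close>.\<close>

lemma centralizer_eq:
  assumes a: "a \<in> carrier G - center G"
    and b: "b \<in> centralizer G {a}" "b \<notin> center G"
  shows "centralizer G {b} = centralizer G {a}"
proof -
  let ?C = "centralizer G {a}" and ?D = "centralizer G (centralizer G {a})"
  have C: "?C \<subseteq> carrier G" and aC: "a \<in> ?C"
    using a by (auto simp: centralizer_def)
  \<comment> \<open>Since \<open>a\<close> commutes with its own centralizer and is not central,
    \<open>?D\<close> is strictly larger than the center.\<close>
  have "a \<in> ?D"
    using a by (auto simp: centralizer_def)
  have sub: "?D \<subseteq> ?C"
    using aC by (auto simp: centralizer_def)
  have "card ?D = p * card (center G)"
  proof (rule card_intermediate_subgroup)
    show "subgroup ?D G"
      using C by (rule subgroup_centralizer)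
    show "center G \<subset> ?D"
      using center_subset_centralizer[OF C] \<open>a \<in> ?D\<close> a by auto
    show "?D \<noteq> carrier G"
      using sub C centralizer_neq_carrier[OF a] by auto
  qed
  \<comment> \<open>Equal orders turn the inclusion into an equality, so the centralizer of
    \<open>a\<close> is abelian.\<close>
  then have "?D = ?C"
    using card_centralizer[OF a] sub C fin by (intro card_subset_eq) (auto dest: finite_subset)
  then have "?C \<subseteq> centralizer G {b}"
    using b(1) by (auto simp: centralizer_def)
  moreover have bG: "b \<in> carrier G - center G"
    using b C by auto
  moreover have "finite (centralizer G {b})"
    using fin by (simp add: centralizer_def)
  ultimately have "centralizer G {a} = centralizer G {b}"
    by (intro card_subset_eq) (simp_all add: card_centralizer[OF a] card_centralizer[OF bG])
  then show ?thesis ..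
qed

text \<open>Commutators are central, so every conjugate of \<open>a\<close> is
  \<open>z \<otimes> a\<close> with \<open>z\<close> central and hence commutes with
  \<open>a\<close>.\<close>

lemma conj_class_subset_centralizer:
  assumes a: "a \<in> carrier G"
  shows "conj_class G a \<subseteq> centralizer G {a}"
proof
  fix b assume "b \<in> conj_class G a"
  then obtain g where g: "g \<in> carrier G" and b: "b = g \<otimes> a \<otimes> inv g"
    using a by (auto simp: conj_class_eq)
  obtain z where z: "z \<in> center G" "g \<otimes> a = z \<otimes> (a \<otimes> g)"
    using quotient_comm[OF g a] by blast
  have zG: "z \<in> carrier G" and za: "z \<otimes> a = a \<otimes> z"
    using z a by (auto simp: center_def)
  have "b = z \<otimes> a"
    using g a zG by (simp add: b z m_assoc)
  moreover have "z \<otimes> a \<otimes> a = a \<otimes> (z \<otimes> a)"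
    by (metis a zG za m_assoc)
  ultimately show "b \<in> centralizer G {a}"
    using a zG by (simp add: centralizer_def)
qed

lemma centralizer_conj:
  assumes "a \<in> carrier G - center G" "b \<in> conj_class G a"
  shows "centralizer G {b} = centralizer G {a}"
proof (rule centralizer_eq[OF assms(1)])
  show "b \<in> centralizer G {a}"
    using assms conj_class_subset_centralizer[of a] by blast
  show "b \<notin> center G"
    using assms(2) conj_class_noncentral[OF assms(1)] by blast
qed

text \<open>Adjacency can be tested on any representatives: centralizers are constant on classes, so
  commuting passes from \<open>x\<close>, \<open>y\<close> to \<open>a\<close>,
  \<open>b\<close>.\<close>

lemma classes_commute_iff:
  assumes a: "a \<in> carrier G - center G" and b: "b \<in> carrier G - center G"
  shows "(\<exists>x\<in>conj_class G a. \<exists>y\<in>conj_class G b. x \<otimes> y = y \<otimes> x) \<longleftrightarrow> b \<in> centralizer G {a}"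
proof
  assume "\<exists>x\<in>conj_class G a. \<exists>y\<in>conj_class G b. x \<otimes> y = y \<otimes> x"
  then obtain x y where xy: "x \<in> conj_class G a" "y \<in> conj_class G b" "x \<otimes> y = y \<otimes> x"
    by blast
  have "x \<in> carrier G - center G" "y \<in> carrier G - center G"
    using xy conj_class_noncentral[OF a] conj_class_noncentral[OF b] by auto
  with xy have "centralizer G {y} = centralizer G {x}"
    by (intro centralizer_eq) (auto simp: centralizer_def)
  then have "centralizer G {b} = centralizer G {a}"
    using centralizer_conj a b xy by simp
  then show "b \<in> centralizer G {a}"
    using b by (auto simp: centralizer_def)
next
  assume "b \<in> centralizer G {a}"
  then show "\<exists>x\<in>conj_class G a. \<exists>y\<in>conj_class G b. x \<otimes> y = y \<otimes> x"
    using a b by (intro bexI[of _ a] bexI[of _ b]) (auto simp: centralizer_def conj_class_self)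
qed

lemma card_conj_class_noncentral:
  assumes "a \<in> carrier G - center G"
  shows "card (conj_class G a) = p"
proof -
  have "card (conj_class G a) * (p * card (center G)) = order G"
    using card_conj_class[of a] assms by (simp add: card_centralizer[OF assms])
  also have "\<dots> = p * (p * card (center G))"
    by (simp add: order_eq power2_eq_square)
  finally show ?thesis
    using card_center_pos prime_gt_0_nat[OF prime] by simp
qed

section \<open>Counting vertices and degrees\<close>

text \<open>The classes partition \<open>S\<close> into blocks of size \<open>p\<close>. The set is
  left general because the count is applied both to all non-central elements and to a single
  clique.\<close>

lemma card_classes:
  assumes S: "S \<subseteq> carrier G - center G" and closed: "\<And>a. a \<in> S \<Longrightarrow> conj_class G a \<subseteq> S"
  shows "p * card (conj_class G ` S) = card S"
proof -
  have "finite S"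
    using fin S finite_subset by blast
  have un: "\<Union> (conj_class G ` S) = S"
    using S closed conj_class_self by blast
  have "p * card (conj_class G ` S) = card (\<Union> (conj_class G ` S))"
  proof (rule card_partition)
    show "finite (\<Union> (conj_class G ` S))"
      using un \<open>finite S\<close> by simp
    show "c1 \<inter> c2 = {}" if "c1 \<in> conj_class G ` S" "c2 \<in> conj_class G ` S" "c1 \<noteq> c2" for c1 c2
      using that S by (auto dest!: conj_class_disjoint)
  qed (use S \<open>finite S\<close> card_conj_class_noncentral in auto)
  then show ?thesis
    by (simp add: un)
qed

text \<open>Multiplied by \<open>p\<close>, as are the next two counts, to avoid division in the
  naturals.\<close>

lemma card_vertices: "p * card (vertices (CCC G)) = (p\<^sup>2 - 1) * card (center G)"
proof -
  have "vertices (CCC G) = conj_class G ` (carrier G - center G)"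
    by (auto simp: vertices_def CCC_def)
  moreover have "p * card (conj_class G ` (carrier G - center G)) = card (carrier G - center G)"
    by (rule card_classes[OF order_refl conj_class_noncentral])
  moreover have "card (carrier G - center G) = order G - card (center G)"
    using subgroup.subset[OF subgroup_center] fin
    by (simp add: card_Diff_subset finite_subset order_def)
  ultimately show ?thesis
    by (simp add: order_eq diff_mult_distrib)
qed

text \<open>These classes form the clique that contains the class of \<open>a\<close>.\<close>

lemma card_clique:
  assumes a: "a \<in> carrier G - center G"
  shows "p * card (conj_class G ` (centralizer G {a} - center G)) = (p - 1) * card (center G)"
proof -
  let ?S = "centralizer G {a} - center G"
  have C: "centralizer G {a} \<subseteq> carrier G"
    by (auto simp: centralizer_def)
  \<comment> \<open>The class of \<open>b\<close> lies in the centralizer of \<open>b\<close>, which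
    is that of \<open>a\<close>.\<close>
  have "conj_class G b \<subseteq> ?S" if b: "b \<in> ?S" for b
    using conj_class_subset_centralizer[of b] conj_class_noncentral[of b] centralizer_eq[OF a, of b] b C
    by blast
  then have "p * card (conj_class G ` ?S) = card ?S"
    using C by (intro card_classes) auto
  also have "\<dots> = card (centralizer G {a}) - card (center G)"
    using center_subset_centralizer[of "{a}"] a fin C
    by (intro card_Diff_subset) (auto dest: finite_subset)
  finally show ?thesis
    using card_centralizer[OF a] by (simp add: diff_mult_distrib)
qed

text \<open>The neighbours of \<open>v\<close> are the other members of its clique; the
  \<open>+ 1\<close> accounts for \<open>v\<close> itself. The right side is the same for all
  vertices, which is regularity.\<close>

lemma degree_CCC:
  assumes "v \<in> vertices (CCC G)"
  shows "p * (vertex_degree (CCC G) v + 1) = (p - 1) * card (center G)"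
proof -
  obtain a where a: "a \<in> carrier G - center G" and v: "v = conj_class G a"
    using assms by (auto simp: vertices_def CCC_def)
  let ?N = "conj_class G ` (centralizer G {a} - center G)"
  have "v \<in> ?N"
    using a v by (auto simp: centralizer_def)
  have "finite ?N"
    using fin by (simp add: centralizer_def)
  \<comment> \<open>An edge at \<open>v\<close> may name it through a representative
    \<open>x\<close> other than \<open>a\<close>; the centralizer is still the same.\<close>
  have same: "centralizer G {x} = centralizer G {a}"
    if "x \<in> carrier G - center G" "v = conj_class G x" for x
    using that a v centralizer_conj[OF a, of x] conj_class_self[of x] by auto
  have "{e \<in> edges (CCC G). v \<in> e} = (\<lambda>w. {v, w}) ` (?N - {v})"
  proof (intro subset_antisym subsetI)
    fix e assume "e \<in> {e \<in> edges (CCC G). v \<in> e}"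
    then obtain x y where xy: "x \<in> carrier G - center G" "y \<in> carrier G - center G"
      "conj_class G x \<noteq> conj_class G y"
      and comm: "\<exists>x'\<in>conj_class G x. \<exists>y'\<in>conj_class G y. x' \<otimes> y' = y' \<otimes> x'"
      and e: "e = {conj_class G x, conj_class G y}" and "v \<in> e"
      unfolding edges_def CCC_def snd_conv mem_Collect_eq by blast
    have y: "y \<in> centralizer G {x}"
      using comm classes_commute_iff[OF xy(1,2)] by simp
    from \<open>v \<in> e\<close> e consider "v = conj_class G x" | "v = conj_class G y"
      by blast
    then show "e \<in> (\<lambda>w. {v, w}) ` (?N - {v})"
    proof cases
      case 1
      then have "y \<in> centralizer G {a}"
        using same xy y by simp
      then show ?thesis
        using 1 xy e by (intro image_eqI[of _ _ "conj_class G y"]) auto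
    next
      case 2
      have "x \<in> centralizer G {y}"
        using xy y by (auto simp: centralizer_def)
      then have "x \<in> centralizer G {a}"
        using same 2 xy by simp
      then show ?thesis
        using 2 xy e by (intro image_eqI[of _ _ "conj_class G x"]) auto
    qed
  next
    fix e assume "e \<in> (\<lambda>w. {v, w}) ` (?N - {v})"
    then obtain b where b: "b \<in> centralizer G {a}" "b \<notin> center G" "conj_class G b \<noteq> v"
      and e: "e = {v, conj_class G b}"
      by auto
    then have bG: "b \<in> carrier G - center G"
      by (auto simp: centralizer_def)
    have "\<exists>x\<in>conj_class G a. \<exists>y\<in>conj_class G b. x \<otimes> y = y \<otimes> x"
      using classes_commute_iff[OF a bG] b(1) by simp
    then have "e \<in> edges (CCC G)"
      unfolding edges_def CCC_def snd_conv mem_Collect_eq using a bG b(3) e v by blast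
    then show "e \<in> {e \<in> edges (CCC G). v \<in> e}"
      using e by simp
  qed
  moreover have "inj_on (\<lambda>w. {v, w}) (?N - {v})"
    by (auto simp: inj_on_def doubleton_eq_iff)
  ultimately have "vertex_degree (CCC G) v = card (?N - {v})"
    by (simp add: vertex_degree_def card_image)
  also have "\<dots> + 1 = card ?N"
    using \<open>v \<in> ?N\<close> \<open>finite ?N\<close> by (metis Suc_eq_plus1 card_Suc_Diff1)
  finally show ?thesis
    using card_clique[OF a] by simp
qed

end

section \<open>From the isomorphism to the counting hypotheses\<close>

lemma (in group) central_quotient_prime_squareI:
  assumes fin: "finite (carrier G)" and prime: "Factorial_Ring.prime p"
    and iso: "G Mod center G \<cong> integer_mod_group p \<times>\<times> integer_mod_group p"
  shows "central_quotient_prime_square G p"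
proof -
  interpret Z: normal "center G" G by (rule normal_center)
  let ?Q = "integer_mod_group p \<times>\<times> integer_mod_group p"
  have p: "p > 1"
    using prime by (rule prime_gt_1_nat)
  \<comment> \<open>Commutativity is carried back along the inverse isomorphism.\<close>
  interpret Q: comm_group "G Mod center G"
  proof (rule comm_group.iso_imp_comm_group)
    show "comm_group ?Q"
      by (intro group.group_comm_groupI) (auto simp: DirProd_group add.commute)
    show "?Q \<cong> G Mod center G"
      using iso Z.factorgroup_is_group by (rule group.iso_sym[rotated])
    show "monoid (G Mod center G)"
      using Z.factorgroup_is_group by (rule group.is_monoid)
  qed
  show ?thesis
  proof
    show "finite (carrier G)" "Factorial_Ring.prime p"
      by fact+
    have "card (rcosets (center G)) = card (carrier ?Q)"
      using iso_same_card[OF iso] by (simp add: FactGroup_def)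
    also have "\<dots> = p\<^sup>2"
      using p by (simp add: carrier_integer_mod_group card_cartesian_product power2_eq_square)
    finally show "order G = p\<^sup>2 * card (center G)"
      using lagrange[OF subgroup_center] by simp
  next
    fix a b assume ab: "a \<in> carrier G" "b \<in> carrier G"
    \<comment> \<open>The two cosets agree because the quotient is commutative; membership of
      \<open>a \<otimes> b\<close> in the second one supplies \<open>z\<close>.\<close>
    have "center G #> (a \<otimes> b) = center G #> (b \<otimes> a)"
      using Q.m_comm[of "center G #> a" "center G #> b"] ab
      by (simp add: Z.rcos_sum FactGroup_def rcosetsI Z.subset)
    then have "a \<otimes> b \<in> center G #> (b \<otimes> a)"
      using rcos_self[OF _ subgroup_center, of "a \<otimes> b"] ab by auto
    then show "\<exists>z\<in>center G. a \<otimes> b = z \<otimes> (b \<otimes> a)"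
      by (auto simp: r_coset_def)
  qed
qed

section \<open>Evaluation of both indices\<close>

theorem theorem2p9:
  fixes G :: "('a, 'b) monoid_scheme" and p :: nat and x :: real
  assumes "Factorial_Ring.prime p"
    and "group G"
    and "finite (carrier G)"
    and "G Mod center G \<cong> integer_mod_group p \<times>\<times> integer_mod_group p"
    and "x = real (card (center G))"
  shows "real (zagreb1 (CCC G)) =
      x * ((real p)^2 - 1) / (real p)^3 *
        ((real p)^2 * x^2 - 2 * real p * x^2 + x^2 - 2 * (real p)^2 * x + 2 * real p * x
          + (real p)^2)
    \<and> real (zagreb2 (CCC G)) =
      x * ((real p)^2 - 1) / (2 * (real p)^4) *
        ((real p)^3 * x^3 - 3 * (real p)^2 * x^3 + 3 * real p * x^3 - x^3
          - 3 * (real p)^3 * x^2 + 6 * (real p)^2 * x^2 - 3 * real p * x^2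
          + 3 * (real p)^3 * x - 3 * (real p)^2 * x - (real p)^3)
    \<and> real (zagreb2 (CCC G)) / real (card (edges (CCC G))) =
      real (zagreb1 (CCC G)) / real (card (vertices (CCC G)))"
proof -
  interpret central_quotient_prime_square G p
    using assms by (intro group.central_quotient_prime_squareI)
  have p: "p > 1"
    using assms(1) by (rule prime_gt_1_nat)
  define V where "V = card (vertices (CCC G))"
  define E where "E = card (edges (CCC G))"
  have V: "real p * real V = ((real p)\<^sup>2 - 1) * x"
    using arg_cong[OF card_vertices, of real] p
    by (simp add: V_def assms(5) of_nat_diff)
  have "((real p)\<^sup>2 - 1) * x > 0"
    using p card_center_pos by (simp add: assms(5))
  then have "V \<noteq> 0"
    using V by (metis less_irrefl mult_zero_right of_nat_0)
  \<comment> \<open>Infinite sets have \<open>card\<close> equal to \<open>0\<close>, so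
    \<open>V \<noteq> 0\<close> rules out both an infinite and an empty vertex set.\<close>
  then have fin_V: "finite (vertices (CCC G))" and "vertices (CCC G) \<noteq> {}"
    by (auto simp: V_def intro: card_ge_0_finite)
  then obtain v where v: "v \<in> vertices (CCC G)"
    by blast
  define k where "k = vertex_degree (CCC G) v"
  \<comment> \<open>The degree of the chosen \<open>v\<close> is the degree of every vertex, since
    \<open>p\<close> cancels in \<open>degree_CCC\<close>.\<close>
  have deg: "vertex_degree (CCC G) w = k" if "w \<in> vertices (CCC G)" for w
  proof -
    have "p * (vertex_degree (CCC G) w + 1) = p * (k + 1)"
      using degree_CCC[OF that] degree_CCC[OF v] by (simp only: k_def)
    then show ?thesis
      using p by (simp del: mult_Suc_right)
  qed
  have k: "real k = ((real p - 1) * x - real p) / real p"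
    using arg_cong[OF degree_CCC[OF v], of real] p
    by (simp add: k_def assms(5) of_nat_diff field_simps)
  have edge: "e \<subseteq> vertices (CCC G) \<and> card e = 2" if "e \<in> edges (CCC G)" for e
    using CCC_simple[OF that] by blast
  note zagreb = zagreb_regular[OF fin_V edge deg, folded V_def E_def]
  have V': "real V = ((real p)\<^sup>2 - 1) * x / real p"
    using V p by (simp add: field_simps)
  have M1: "real (zagreb1 (CCC G)) = real V * (real k)\<^sup>2"
    by (simp add: zagreb(1))
  have E: "real E = real V * real k / 2"
    using arg_cong[OF zagreb(3), of real] by simp
  have M2: "real (zagreb2 (CCC G)) = real V * (real k) ^ 3 / 2"
    by (simp add: zagreb(2) E power2_eq_square power3_eq_cube)
  \<comment> \<open>For \<open>k = 0\<close> the numerator vanishes and the quotient is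
    \<open>0\<close>; otherwise \<open>E\<close> is nonzero and cancels.\<close>
  have "real (zagreb2 (CCC G)) / real E = (real k)\<^sup>2"
  proof (cases "k = 0")
    case False
    with \<open>V \<noteq> 0\<close> zagreb(3) have "E \<noteq> 0"
      by (metis mult_eq_0_iff)
    then show ?thesis
      by (simp add: zagreb(2))
  qed (simp add: zagreb(2))
  also have "\<dots> = real (zagreb1 (CCC G)) / real V"
    using \<open>V \<noteq> 0\<close> by (simp add: M1)
  finally have ratio: "real (zagreb2 (CCC G)) / real E = real (zagreb1 (CCC G)) / real V" .
  \<comment> \<open>The long polynomials of the statement are the expanded square and cube of
    \<open>(p - 1) * x - p\<close>, which is \<open>p * k\<close>.\<close>
  have "real (zagreb1 (CCC G)) =
      x * ((real p)^2 - 1) / (real p)^3 * ((real p - 1) * x - real p)\<^sup>2"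
    unfolding M1 V' k using p by (simp add: field_simps power2_eq_square power3_eq_cube)
  moreover have "real (zagreb2 (CCC G)) =
      x * ((real p)^2 - 1) / (2 * (real p)^4) * ((real p - 1) * x - real p) ^ 3"
    unfolding M2 V' k using p by (simp add: power_divide power4_eq_xxxx power3_eq_cube mult_ac)
  ultimately show ?thesis
    using ratio unfolding V_def E_def
    by (simp add: power2_eq_square power3_eq_cube algebra_simps)
qed

end
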